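(* Let $g\in\mathbb{R}^n\setminus\{0\}$, let $H$ be a real symmetric $n\times n$ matrix, and let $\rho:\mathbb{R}\to[0,\infty]$ be a proper closed convex function with $\rho(0)=0$. Suppose that $\rho$ is nondecreasing, $\rho(t)=0$ for all $t\le 0$, and there exists $t_0>0$ with $\rho(t_0)<\infty$. Let $$v_{\rho r}:=\inf_{x\in\mathbb{R}^n}\ 2g^Tx+x^THx+\rho(\|x\|^2),$$ and consider the concave maximization problem $$v_{\rho d}:=\sup_{\lambda\in\mathbb{R}}\left\{-g^T(H-\lambda I)^\dagger g-\rho^+(-\lambda)\ :\ \lambda\le 0,\ H-\lambda I\succeq 0,\ g\in{\rm Range}(H-\lambda I)\right\}.$$ Then $v_{\rho d}=v_{\rho r}$, and the supremum defining $v_{\rho d}$ is attained (a solution of the maximization problem exists) whenever $v_{\rho r}$ is finite.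
   Context: $\|\cdot\|$ is the Euclidean norm, $I$ the identity matrix, $A^\dagger$ the Moore-Penrose pseudoinverse of a symmetric matrix $A$, and $A\succeq 0$ means positive semidefinite. The monotone conjugate of $\rho$ is $\rho^+(u):=\sup_{t\ge 0}\{ut-\rho(t)\}$. Values are in the extended reals, and a supremum over the empty set is $-\infty$. *)

theory Defs
  imports "HOL-Analysis.Analysis"
begin

definition psd :: "real ^ 'n ^ 'n \<Rightarrow> bool" where
  "psd A \<longleftrightarrow> transpose A = A \<and> (\<forall>x. 0 \<le> x \<bullet> (A *v x))"

(* The four Penrose equations have exactly one solution for every real matrix A. *)
definition pinv :: "real ^ 'n ^ 'n \<Rightarrow> real ^ 'n ^ 'n" where
  "pinv A = (THE X. A ** X ** A = A \<and> X ** A ** X = X \<and>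
                    transpose (A ** X) = A ** X \<and> transpose (X ** A) = X ** A)"

(* The library's epigraph is for real-valued functions on a set; for extended-valued
   functions the second coordinate still ranges over the reals. *)
definition epi :: "(real \<Rightarrow> ereal) \<Rightarrow> (real \<times> real) set" where
  "epi f = {(t, r). f t \<le> ereal r}"

definition proper_fun :: "(real \<Rightarrow> ereal) \<Rightarrow> bool" where
  "proper_fun f \<longleftrightarrow> (\<forall>t. f t \<noteq> -\<infinity>) \<and> (\<exists>t. f t \<noteq> \<infinity>)"

definition closed_fun :: "(real \<Rightarrow> ereal) \<Rightarrow> bool" where
  "closed_fun f \<longleftrightarrow> closed (epi f)"

definition convex_fun :: "(real \<Rightarrow> ereal) \<Rightarrow> bool" where
  "convex_fun f \<longleftrightarrow> convex (epi f)"

definition monotone_conj :: "(real \<Rightarrow> ereal) \<Rightarrow> real \<Rightarrow> ereal" where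
  "monotone_conj \<rho> u = (SUP t\<in>{0..}. ereal (u * t) - \<rho> t)"

definition v_rr :: "real ^ 'n \<Rightarrow> real ^ 'n ^ 'n \<Rightarrow> (real \<Rightarrow> ereal) \<Rightarrow> ereal" where
  "v_rr g H \<rho> = (INF x. ereal (2 * (g \<bullet> x) + x \<bullet> (H *v x)) + \<rho> ((norm x)\<^sup>2))"

definition dual_feasible :: "real ^ 'n \<Rightarrow> real ^ 'n ^ 'n \<Rightarrow> real set" where
  "dual_feasible g H =
     {l. l \<le> 0 \<and> psd (H - l *\<^sub>R mat 1) \<and> g \<in> range (\<lambda>x. (H - l *\<^sub>R mat 1) *v x)}"

(* Never of the form \<infinity> - \<infinity>: the first term is finite. *)
definition dual_obj :: "real ^ 'n \<Rightarrow> real ^ 'n ^ 'n \<Rightarrow> (real \<Rightarrow> ereal) \<Rightarrow> real \<Rightarrow> ereal" where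
  "dual_obj g H \<rho> l =
     ereal (- (g \<bullet> (pinv (H - l *\<^sub>R mat 1) *v g))) - monotone_conj \<rho> (- l)"

(* In ereal the supremum of the empty set is -\<infinity>. *)
definition v_rd :: "real ^ 'n \<Rightarrow> real ^ 'n ^ 'n \<Rightarrow> (real \<Rightarrow> ereal) \<Rightarrow> ereal" where
  "v_rd g H \<rho> = (SUP l\<in>dual_feasible g H. dual_obj g H \<rho> l)"

end

theory Submission
  imports Defs
begin

text \<open>The set of pairs \<open>(t, r)\<close> such that some \<open>x\<close> satisfies \<open>\<parallel>x\<parallel>\<^sup>2 \<le> t\<close> and
  \<open>2 g\<^sup>T x + x\<^sup>T H x \<le> r\<close> is convex, although the quadratic is not: on the line through
  two points, the quadratic and the squared norm differ, up to a factor, by an affine function, and the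
  sphere of the interpolated radius meets this line on both sides of the convex combination.
  If the primal value \<open>v\<close> is finite, this set is disjoint from the convex set
  \<open>{(t, r). r < v - \<rho> t}\<close>, and a line separating the two in the plane is not vertical,
  because \<open>\<rho>\<close> is finite at some \<open>t\<^sub>0 > 0\<close>. Its slope is a dual solution.\<close>

subsection \<open>The Moore-Penrose inverse of a symmetric matrix\<close>

definition penrose :: "real ^ 'n ^ 'n \<Rightarrow> real ^ 'n ^ 'n \<Rightarrow> bool" where
  "penrose A X \<longleftrightarrow> A ** X ** A = A \<and> X ** A ** X = X \<and>
     transpose (A ** X) = A ** X \<and> transpose (X ** A) = X ** A"

text \<open>\<open>A ** X\<close> and \<open>A ** Y\<close> are both the orthogonal projection onto
  the range of \<open>A\<close>, and \<open>X ** A\<close>, \<open>Y ** A\<close> the one onto its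
  row space. Hence X = XAX = XAY = YAY = Y.\<close>

lemma penrose_unique:
  assumes X: "penrose A X" and Y: "penrose A Y"
  shows "X = Y"
proof -
  have tr: "transpose A ** transpose Z ** transpose A = transpose A" if "penrose A Z" for Z
    using that by (metis penrose_def matrix_transpose_mul matrix_mul_assoc)
  have "A ** X = transpose X ** (transpose A ** transpose Y ** transpose A)"
    using X tr[OF Y] by (metis penrose_def matrix_transpose_mul)
  also have "\<dots> = transpose (A ** X) ** transpose (A ** Y)"
    by (simp add: matrix_transpose_mul matrix_mul_assoc)
  also have "\<dots> = A ** Y"
    using X Y by (simp add: penrose_def matrix_mul_assoc)
  finally have AXY: "A ** X = A ** Y" .
  have "Y ** A = (transpose A ** transpose X ** transpose A) ** transpose Y"
    using Y tr[OF X] by (metis penrose_def matrix_transpose_mul)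
  also have "\<dots> = transpose (X ** A) ** transpose (Y ** A)"
    by (simp add: matrix_transpose_mul matrix_mul_assoc)
  also have "\<dots> = X ** (A ** Y ** A)"
    using X Y by (metis penrose_def matrix_mul_assoc)
  also have "\<dots> = X ** A"
    using Y by (simp add: penrose_def)
  finally have YXA: "Y ** A = X ** A" .
  show ?thesis
    using X Y AXY YXA by (metis penrose_def matrix_mul_assoc)
qed

lemma transpose_0: "transpose (0 :: 'a::zero ^ 'm ^ 'n) = 0"
  by (simp add: transpose_def vec_eq_iff)

lemma transpose_diff:
  fixes A B :: "'a::ring ^ 'm ^ 'n"
  shows "transpose (A - B) = transpose A - transpose B"
  by (simp add: transpose_def vec_eq_iff)

lemma matrix_add_rdistrib:
  fixes A B :: "'a::semiring_1 ^ 'm ^ 'n" and C :: "'a ^ 'k ^ 'm"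
  shows "(A + B) ** C = A ** C + B ** C"
  by (simp add: matrix_matrix_mult_def vec_eq_iff sum.distrib distrib_right)

lemma matrix_diff_ldistrib:
  fixes A :: "'a::ring_1 ^ 'm ^ 'n" and B C :: "'a ^ 'k ^ 'm"
  shows "A ** (B - C) = A ** B - A ** C"
  by (simp add: matrix_matrix_mult_def vec_eq_iff sum_subtractf right_diff_distrib)

lemma matrix_diff_rdistrib:
  fixes A B :: "'a::ring_1 ^ 'm ^ 'n" and C :: "'a ^ 'k ^ 'm"
  shows "(A - B) ** C = A ** C - B ** C"
  by (simp add: matrix_matrix_mult_def vec_eq_iff sum_subtractf left_diff_distrib)

lemma symmetric_inner:
  fixes A :: "real ^ 'n ^ 'n"
  assumes "transpose A = A"
  shows "x \<bullet> (A *v y) = (A *v x) \<bullet> y"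
  by (metis assms dot_lmul_matrix vector_transpose_matrix)

lemma symmetricI:
  fixes A :: "real ^ 'n ^ 'n"
  assumes "\<And>x y. x \<bullet> (A *v y) = (A *v x) \<bullet> y"
  shows "transpose A = A"
proof -
  have "x \<bullet> (transpose A *v y) = x \<bullet> (A *v y)" for x y
    by (metis assms dot_lmul_matrix matrix_vector_mul_assoc transpose_matrix_vector inner_commute)
  then show ?thesis
    by (metis matrix_eq vector_eq_rdot inner_commute)
qed

lemma orthogonal_projection_matrix:
  fixes S :: "(real ^ 'n) set"
  assumes "subspace S"
  obtains P :: "real ^ 'n ^ 'n" where "transpose P = P" "\<And>x. P *v x \<in> S" "\<And>x. x \<in> S \<Longrightarrow> P *v x = x"
proof -
  obtain B where B: "B \<subseteq> S" "pairwise orthogonal B" "\<And>x. x \<in> B \<Longrightarrow> norm x = 1"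
      "independent B" "span B = S"
    using orthonormal_basis_subspace[OF assms] by metis
  have fin: "finite B" using B(4) by (simp add: independent_imp_finite)
  \<comment> \<open>Orthogonal projection written in an orthonormal basis; it fixes each basis
    vector, hence by linearity all of \<open>S\<close>.\<close>
  define f where "f x = (\<Sum>b\<in>B. (b \<bullet> x) *\<^sub>R b)" for x
  have lin: "linear f"
    by (rule linearI) (simp_all add: f_def inner_add_right scaleR_add_left sum.distrib scaleR_sum_right)
  then have P: "matrix f *v x = f x" for x by (simp add: matrix_works)
  have sym: "x \<bullet> f y = f x \<bullet> y" for x y
    unfolding f_def inner_sum_right inner_sum_left
    by (rule sum.cong) (auto simp: inner_commute)
  have in_S: "f x \<in> S" for x
    unfolding f_def B(5)[symmetric] by (intro span_sum span_scale span_base)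
  have f_base: "f b = b" if "b \<in> B" for b
  proof -
    have "f b = (\<Sum>c\<in>B. if c = b then b else 0)"
      unfolding f_def
    proof (rule sum.cong)
      fix c assume c: "c \<in> B"
      show "(c \<bullet> b) *\<^sub>R c = (if c = b then b else 0)"
        using B(2) B(3)[OF c] c that
        by (auto simp: pairwise_def orthogonal_def norm_eq_1)
    qed simp
    then show ?thesis using fin that by simp
  qed
  have "f x = x" if "x \<in> S" for x
    using linear_eq_on_span[OF lin linear_ident f_base] that B(5) by simp
  with sym in_S show ?thesis
    by (intro that[of "matrix f"]) (auto simp: P intro!: symmetricI)
qed

text \<open>Let \<open>P\<close> be the orthogonal projection onto the kernel of \<open>A\<close>.
  Then \<open>A + P\<close> is invertible, and its inverse minus \<open>P\<close> solves the Penrose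
  equations: both products with \<open>A\<close> equal \<open>mat 1 - P\<close>.\<close>

lemma penrose_exists:
  fixes A :: "real ^ 'n ^ 'n"
  assumes sym: "transpose A = A"
  shows "\<exists>X. penrose A X"
proof -
  have "subspace {x. A *v x = 0}"
    by (auto simp: subspace_def matrix_vector_right_distrib matrix_vector_mult_scaleR)
  then obtain P :: "real ^ 'n ^ 'n" where P: "transpose P = P"
      "\<And>x. A *v (P *v x) = 0" "\<And>x. A *v x = 0 \<Longrightarrow> P *v x = x"
    using orthogonal_projection_matrix by (metis (mono_tags, lifting) mem_Collect_eq)
  have AP: "A ** P = 0"
    by (simp add: matrix_eq P(2) flip: matrix_vector_mul_assoc)
  then have PA: "P ** A = 0"
    by (metis P(1) sym matrix_transpose_mul transpose_0)
  have PP: "P ** P = P"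
    by (simp add: matrix_eq P flip: matrix_vector_mul_assoc)
  define N where "N = A + P"
  have PN: "P ** N = P" and NP: "N ** P = P"
    by (simp_all add: N_def PA AP PP matrix_add_ldistrib matrix_add_rdistrib)
  have "x = 0" if "N *v x = 0" for x
  proof -
    have Px: "P *v x = 0"
      using that PN by (metis matrix_vector_mul_assoc matrix_vector_mult_0_right)
    then have "A *v x = 0"
      using that by (simp add: N_def matrix_vector_mult_add_rdistrib)
    then show ?thesis using P(3) Px by simp
  qed
  then obtain K where KN: "K ** N = mat 1"
    using matrix_left_invertible_ker by blast
  then have NK: "N ** K = mat 1" by (simp add: matrix_left_right_inverse)
  have PK: "P ** K = P"
    by (metis PN NK matrix_mul_assoc matrix_mul_rid)
  have KP: "K ** P = P"
    by (metis NP KN matrix_mul_assoc matrix_mul_lid)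
  have A: "A = N - P" by (simp add: N_def)
  define X where "X = K - P"
  have AX: "A ** X = mat 1 - P" and XA: "X ** A = mat 1 - P"
    unfolding A X_def
    by (simp_all add: matrix_diff_ldistrib matrix_diff_rdistrib NK KN PK KP NP PN PP)
  have "penrose A X"
    unfolding penrose_def AX XA
    by (simp add: matrix_diff_rdistrib PA transpose_diff P(1) transpose_mat)
       (simp add: X_def matrix_diff_ldistrib PK PP)
  then show ?thesis ..
qed

lemma penrose_pinv:
  assumes "transpose A = A"
  shows "penrose A (pinv A)"
proof -
  have "\<exists>!X. penrose A X" using penrose_exists[OF assms] penrose_unique by blast
  then have "penrose A (THE X. penrose A X)" by (rule theI')
  then show ?thesis by (simp add: penrose_def pinv_def)
qed

subsection \<open>Quadratic functions bounded below\<close>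

text \<open>Completing the square: if \<open>g = A *v y\<close>, the minimum is attained at
  \<open>- y\<close> and equals \<open>- (y \<bullet> (A *v y))\<close>, which the first Penrose
  equation rewrites through \<open>pinv A\<close>.\<close>

lemma pinv_lower_bound:
  fixes A :: "real ^ 'n ^ 'n"
  assumes A: "psd A" and g: "g \<in> range ((*v) A)"
  shows "- (g \<bullet> (pinv A *v g)) \<le> 2 * (g \<bullet> x) + x \<bullet> (A *v x)"
    and "\<exists>x. 2 * (g \<bullet> x) + x \<bullet> (A *v x) = - (g \<bullet> (pinv A *v g))"
proof -
  have sym: "transpose A = A" using A by (simp add: psd_def)
  obtain y where y: "g = A *v y" using g by blast
  have "A *v (pinv A *v (A *v y)) = A *v y"
    using penrose_pinv[OF sym] by (simp add: penrose_def matrix_vector_mul_assoc matrix_mul_assoc)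
  then have val: "g \<bullet> (pinv A *v g) = y \<bullet> (A *v y)"
    unfolding y by (metis sym symmetric_inner)
  have sq: "2 * (g \<bullet> x) + x \<bullet> (A *v x) = (x + y) \<bullet> (A *v (x + y)) - y \<bullet> (A *v y)" for x
    unfolding y using symmetric_inner[OF sym, of x y] symmetric_inner[OF sym, of y x]
    by (simp add: matrix_vector_right_distrib inner_add_left inner_add_right inner_commute)
  show "- (g \<bullet> (pinv A *v g)) \<le> 2 * (g \<bullet> x) + x \<bullet> (A *v x)"
    using A unfolding sq val psd_def by (simp add: inner_commute)
  show "\<exists>x. 2 * (g \<bullet> x) + x \<bullet> (A *v x) = - (g \<bullet> (pinv A *v g))"
    unfolding sq val by (rule exI[of _ "- y"]) simp
qed

lemma quadratic_bounded_below:
  fixes a b c :: real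
  assumes "\<And>s. c \<le> 2 * b * s + a * s\<^sup>2"
  shows "0 \<le> a" and "a = 0 \<Longrightarrow> b = 0"
proof -
  show "0 \<le> a"
  proof (rule ccontr)
    assume a: "\<not> 0 \<le> a"
    \<comment> \<open>Chosen so that \<open>a * s\<^sup>2 = - (1 + \<bar>c\<bar>)\<close>; adding
      the bounds at \<open>s\<close> and \<open>- s\<close> cancels the linear term.\<close>
    define s where "s = sqrt ((1 + \<bar>c\<bar>) / - a)"
    have "s\<^sup>2 = (1 + \<bar>c\<bar>) / - a"
      using a unfolding s_def by (intro real_sqrt_pow2) (simp add: divide_nonneg_neg)
    then have "a * s\<^sup>2 = - (1 + \<bar>c\<bar>)" using a by simp
    then show False using assms[of s] assms[of "- s"] by simp
  qed
  show "b = 0" if "a = 0"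
    using assms[of "(c - 1) / (2 * b)"] that by (cases "b = 0") auto
qed

text \<open>On each line through the origin the function is a quadratic in one variable. Its leading
  coefficient must be nonnegative, and along the kernel of \<open>A\<close>, where it is linear, its
  slope must vanish.\<close>

lemma bounded_below_imp_psd_range:
  fixes A :: "real ^ 'n ^ 'n"
  assumes sym: "transpose A = A"
    and bd: "\<And>x. c \<le> 2 * (g \<bullet> x) + x \<bullet> (A *v x)"
  shows "psd A" and "g \<in> range ((*v) A)"
proof -
  have line: "c \<le> 2 * (g \<bullet> x) * s + (x \<bullet> (A *v x)) * s\<^sup>2" for x s
    using bd[of "s *\<^sub>R x"]
    by (simp add: matrix_vector_mult_scaleR power2_eq_square algebra_simps)
  show "psd A"
    using sym quadratic_bounded_below(1)[OF line] by (simp add: psd_def)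
  let ?X = "pinv A"
  let ?y = "A *v (?X *v g)"
  \<comment> \<open>The component of \<open>g\<close> orthogonal to the range of \<open>A\<close>.
    It lies in the kernel of \<open>A\<close>, so \<open>g \<bullet> z = 0\<close>, while also
    \<open>g \<bullet> z = z \<bullet> z\<close>.\<close>
  define z where "z = g - ?y"
  have pen: "A ** ?X ** A = A" "transpose (A ** ?X) = A ** ?X"
    using penrose_pinv[OF sym] by (simp_all add: penrose_def)
  have "A ** (A ** ?X) = transpose (A ** ?X ** A)"
    by (metis pen(2) sym matrix_transpose_mul)
  then have "A *v ?y = A *v g"
    by (simp add: matrix_vector_mul_assoc pen(1) sym)
  then have Az: "A *v z = 0"
    by (simp add: z_def matrix_vector_mult_diff_distrib)
  then have "?y \<bullet> z = 0"
    by (metis sym symmetric_inner inner_commute inner_zero_left)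
  then have "g \<bullet> z = z \<bullet> z"
    by (simp add: z_def inner_diff_left)
  moreover have "g \<bullet> z = 0"
    using quadratic_bounded_below(2)[OF line, of z] Az by simp
  ultimately have "g = ?y" by (simp add: z_def)
  then show "g \<in> range ((*v) A)" by blast
qed

subsection \<open>Hidden convexity\<close>

text \<open>The product of the roots is \<open>c / a \<le> 0\<close>, so zero lies between them; the
  sign of \<open>m\<close> decides which root to take.\<close>

lemma quadratic_root_on_side:
  fixes a b c m :: real
  assumes "0 < a" "c \<le> 0"
  shows "\<exists>u. a * u\<^sup>2 + b * u + c = 0 \<and> m * u \<le> 0"
proof -
  define D where "D = b\<^sup>2 - 4 * a * c"
  have D: "b\<^sup>2 \<le> D" using assms by (simp add: D_def mult_nonneg_nonpos)
  then have sq: "(sqrt D)\<^sup>2 = D" by (smt (verit) real_sqrt_pow2 zero_le_power2)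
  have b: "\<bar>b\<bar> \<le> sqrt D" using D by (rule real_le_rsqrt[of "\<bar>b\<bar>", simplified])
  have root: "a * u\<^sup>2 + b * u + c = 0" if "u = (- b + w) / (2 * a)" "w\<^sup>2 = D" for u w
  proof -
    have "2 * a * u + b = w" using that(1) assms by simp
    then have "(2 * a * u + b)\<^sup>2 = b\<^sup>2 - 4 * a * c" using that(2) D_def by simp
    then have "4 * a * (a * u\<^sup>2 + b * u + c) = 0" by (simp add: power2_eq_square algebra_simps)
    then show ?thesis using assms by simp
  qed
  show ?thesis
  proof (cases "0 \<le> m")
    case True
    have "(- b + - sqrt D) / (2 * a) \<le> 0" using b assms by (simp add: divide_simps)
    with True root[OF refl, of "- sqrt D"] sq show ?thesis
      by (metis mult_nonneg_nonpos power2_minus)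
  next
    case False
    have "0 \<le> (- b + sqrt D) / (2 * a)" using b assms by (simp add: divide_simps)
    with False root[OF refl, of "sqrt D"] sq show ?thesis
      by (metis mult_nonpos_nonneg linear)
  qed
qed

lemma quadratic_sphere_interpolation:
  fixes H :: "real ^ 'n ^ 'n" and x y g :: "real ^ 'n"
  defines "q \<equiv> \<lambda>x. 2 * (g \<bullet> x) + x \<bullet> (H *v x)"
  assumes ab: "0 \<le> \<alpha>" "0 \<le> \<beta>" "\<alpha> + \<beta> = 1"
  shows "\<exists>z. (norm z)\<^sup>2 = \<alpha> * (norm x)\<^sup>2 + \<beta> * (norm y)\<^sup>2 \<and> q z \<le> \<alpha> * q x + \<beta> * q y"
proof (cases "x = y")
  case True
  then show ?thesis using ab by (intro exI[of _ x]) (simp flip: distrib_right)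
next
  case False
  have \<alpha>: "\<alpha> = 1 - \<beta>" using ab by simp
  define d where "d = y - x"
  define a where "a = d \<bullet> d"
  define A where "A = d \<bullet> (H *v d)"
  define b where "b = 2 * (x \<bullet> d)"
  define B where "B = 2 * (g \<bullet> d) + x \<bullet> (H *v d) + d \<bullet> (H *v x)"
  have a: "0 < a" using False by (simp add: a_def d_def)
  have n: "(norm (x + s *\<^sub>R d))\<^sup>2 = (norm x)\<^sup>2 + b * s + a * s\<^sup>2" for s
    unfolding power2_norm_eq_inner
    by (simp add: a_def b_def inner_add_left inner_add_right
        inner_commute power2_eq_square algebra_simps)
  have qs: "q (x + s *\<^sub>R d) = q x + B * s + A * s\<^sup>2" for s
    by (simp add: q_def A_def B_def inner_add_left inner_add_right matrix_vector_right_distrib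
        matrix_vector_mult_scaleR power2_eq_square algebra_simps)
  have ny: "(norm y)\<^sup>2 = (norm x)\<^sup>2 + b + a" and qy: "q y = q x + B + A"
    using n[of 1] qs[of 1] by (simp_all add: d_def)
  define t where "t = \<alpha> * (norm x)\<^sup>2 + \<beta> * (norm y)\<^sup>2"
  have t: "t = (norm x)\<^sup>2 + \<beta> * (b + a)" by (simp add: t_def \<alpha> ny algebra_simps)
  \<comment> \<open>The convex combination sits at parameter \<open>\<beta>\<close> of the line, and
    \<open>u\<close> is the displacement from it. Expanding
    \<open>b * s + a * s\<^sup>2 = \<beta> * (b + a)\<close> at \<open>s = \<beta> + u\<close>
    leaves this constant term.\<close>
  define c where "c = - a * \<beta> * (1 - \<beta>)"
  have "c \<le> 0" using a ab by (simp add: c_def mult_nonneg_nonneg)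
  \<comment> \<open>\<open>m\<close> is the slope of the affine function \<open>q - (A / a) \<parallel>\<cdot>\<parallel>\<^sup>2\<close> along the line.\<close>
  define m where "m = B - A / a * b"
  obtain u where u: "a * u\<^sup>2 + (b + 2 * a * \<beta>) * u + c = 0" "m * u \<le> 0"
    using quadratic_root_on_side[OF a \<open>c \<le> 0\<close>] by blast
  define z where "z = x + (\<beta> + u) *\<^sub>R d"
  have eq: "b * (\<beta> + u) + a * (\<beta> + u)\<^sup>2 = \<beta> * (b + a)"
    using u(1) by (simp add: c_def power2_eq_square algebra_simps)
  then have "(norm z)\<^sup>2 = t" by (simp add: z_def n t)
  moreover have "q z \<le> \<alpha> * q x + \<beta> * q y"
  proof -
    \<comment> \<open>The sphere equation eliminates the square, so that \<open>q z\<close> differs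
      from the interpolated value by exactly \<open>m * u\<close>.\<close>
    have "A * (\<beta> + u)\<^sup>2 = A / a * (\<beta> * (b + a) - b * (\<beta> + u))"
      using a by (simp flip: eq)
    then have "q z = q x + \<beta> * (B + A) + m * u"
      using a unfolding z_def qs m_def by (simp add: field_simps)
    then show ?thesis using u(2) by (simp add: \<alpha> qy algebra_simps)
  qed
  ultimately show ?thesis unfolding t_def by blast
qed

text \<open>With inequalities the set is also upward closed in \<open>t\<close> and
  \<open>r\<close>, which later fixes the signs of the normal vector of the separating line.\<close>

lemma convex_quadratic_norm_set:
  fixes H :: "real ^ 'n ^ 'n" and g :: "real ^ 'n"
  shows "convex {(t, r). \<exists>x. (norm x)\<^sup>2 \<le> t \<and> 2 * (g \<bullet> x) + x \<bullet> (H *v x) \<le> r}"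
proof (rule convexI, clarsimp)
  fix t1 t2 r1 r2 \<alpha> \<beta> :: real and x y :: "real ^ 'n"
  assume ab: "0 \<le> \<alpha>" "0 \<le> \<beta>" "\<alpha> + \<beta> = 1"
    and x: "(norm x)\<^sup>2 \<le> t1" "2 * (g \<bullet> x) + x \<bullet> (H *v x) \<le> r1"
    and y: "(norm y)\<^sup>2 \<le> t2" "2 * (g \<bullet> y) + y \<bullet> (H *v y) \<le> r2"
  show "\<exists>z. (norm z)\<^sup>2 \<le> \<alpha> * t1 + \<beta> * t2 \<and> 2 * (g \<bullet> z) + z \<bullet> (H *v z) \<le> \<alpha> * r1 + \<beta> * r2"
    using quadratic_sphere_interpolation[OF ab, of x y g H]
      mult_left_mono[OF x(1) ab(1)] mult_left_mono[OF x(2) ab(1)]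
      mult_left_mono[OF y(1) ab(2)] mult_left_mono[OF y(2) ab(2)]
    by (smt (verit))
qed

lemma convex_strict_hypograph:
  assumes "convex_fun \<rho>"
  shows "convex {(t, r). \<rho> t < ereal (v - r)}"
proof (rule convexI, clarsimp)
  fix t1 t2 r1 r2 \<alpha> \<beta> :: real
  assume ab: "0 \<le> \<alpha>" "0 \<le> \<beta>" "\<alpha> + \<beta> = 1"
    and 1: "\<rho> t1 < ereal (v - r1)" and 2: "\<rho> t2 < ereal (v - r2)"
  \<comment> \<open>A real number strictly in between gives a point of \<open>epi \<rho>\<close> and
    keeps some slack for the strict inequality.\<close>
  obtain s1 where s1: "\<rho> t1 < ereal s1" "s1 < v - r1"
    using ereal_dense2[OF 1] by auto
  obtain s2 where s2: "\<rho> t2 < ereal s2" "s2 < v - r2"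
    using ereal_dense2[OF 2] by auto
  have "\<alpha> *\<^sub>R (t1, s1) + \<beta> *\<^sub>R (t2, s2) \<in> epi \<rho>"
    using assms ab s1 s2 unfolding convex_fun_def
    by (intro convexD) (auto simp: epi_def)
  then have "\<rho> (\<alpha> * t1 + \<beta> * t2) \<le> ereal (\<alpha> * s1 + \<beta> * s2)"
    by (simp add: epi_def)
  moreover have "\<alpha> * s1 + \<beta> * s2 < \<alpha> * (v - r1) + \<beta> * (v - r2)"
  proof (cases "\<alpha> = 0")
    case False
    with ab s1(2) s2(2) show ?thesis
      by (intro add_less_le_mono mult_left_mono mult_strict_left_mono) auto
  qed (use ab s2(2) in simp)
  moreover have "\<alpha> * (v - r1) + \<beta> * (v - r2) = (\<alpha> + \<beta>) * v - (\<alpha> * r1 + \<beta> * r2)"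
    by (simp add: algebra_simps)
  ultimately show "\<rho> (\<alpha> * t1 + \<beta> * t2) < ereal (v - (\<alpha> * r1 + \<beta> * r2))"
    using ab(3) by (simp add: order_le_less_trans)
qed

subsection \<open>Duality\<close>

lemma shifted_quadratic:
  fixes H :: "real ^ 'n ^ 'n"
  shows "x \<bullet> ((H - l *\<^sub>R mat 1) *v x) = x \<bullet> (H *v x) - l * (norm x)\<^sup>2"
  by (simp add: matrix_vector_mult_diff_rdistrib scaleR_matrix_vector_assoc[symmetric]
      inner_diff_right power2_norm_eq_inner)

text \<open>Two bounds are added: the pseudoinverse term is a lower bound of the quadratic shifted
  by \<open>l\<close>, and the conjugate satisfies the Fenchel-Young inequality at
  \<open>t = \<parallel>x\<parallel>\<^sup>2\<close>.\<close>

lemma weak_duality: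
  fixes g :: "real ^ 'n" and H :: "real ^ 'n ^ 'n"
  assumes "\<And>t. 0 \<le> \<rho> t"
  shows "v_rd g H \<rho> \<le> v_rr g H \<rho>"
  unfolding v_rd_def v_rr_def
proof (rule SUP_least, rule INF_greatest)
  fix l and x :: "real ^ 'n"
  assume l: "l \<in> dual_feasible g H"
  let ?M = "H - l *\<^sub>R mat 1" and ?t = "(norm x)\<^sup>2"
  have "- (g \<bullet> (pinv ?M *v g)) \<le> 2 * (g \<bullet> x) + x \<bullet> (?M *v x)"
    using l pinv_lower_bound(1) by (auto simp: dual_feasible_def)
  then have bd: "- (g \<bullet> (pinv ?M *v g)) \<le> 2 * (g \<bullet> x) + x \<bullet> (H *v x) - l * ?t"
    by (simp add: shifted_quadratic)
  have conj: "ereal (- l * ?t) - \<rho> ?t \<le> monotone_conj \<rho> (- l)"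
    unfolding monotone_conj_def by (rule SUP_upper) simp
  show "dual_obj g H \<rho> l \<le> ereal (2 * (g \<bullet> x) + x \<bullet> (H *v x)) + \<rho> ?t"
  proof (cases "\<rho> ?t")
    case (real r)
    have "dual_obj g H \<rho> l \<le> ereal (- (g \<bullet> (pinv ?M *v g))) - ereal (- l * ?t - r)"
      unfolding dual_obj_def using conj real by (intro ereal_minus_mono) auto
    also have "\<dots> \<le> ereal (2 * (g \<bullet> x) + x \<bullet> (H *v x)) + \<rho> ?t"
      using bd real by simp
    finally show ?thesis .
  qed (use assms[of ?t] in auto)
qed

text \<open>On the side of \<open>S\<close>, the separating line bounds the shifted quadratic below
  by \<open>c\<close>, which makes \<open>l\<close> feasible; on the side of \<open>T\<close>, it
  bounds the conjugate above by \<open>c - v\<close>. The difference of the bounds is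
  \<open>v\<close>.\<close>

lemma strong_duality:
  fixes g :: "real ^ 'n" and H :: "real ^ 'n ^ 'n"
  assumes sym: "transpose H = H"
    and nonneg: "\<And>t. 0 \<le> \<rho> t" and conv: "convex_fun \<rho>" and "mono \<rho>" and zero: "\<rho> 0 = 0"
    and slater: "0 < t0" "\<rho> t0 < \<infinity>"
    and v: "v_rr g H \<rho> = ereal v"
  shows "\<exists>l\<in>dual_feasible g H. ereal v \<le> dual_obj g H \<rho> l"
proof -
  define q where "q x = 2 * (g \<bullet> x) + x \<bullet> (H *v x)" for x
  define S where "S = {(t, r). \<exists>x. (norm x)\<^sup>2 \<le> t \<and> q x \<le> r}"
  define T where "T = {(t, r). \<rho> t < ereal (v - r)}"
  have S: "(t, r) \<in> S" if "(norm x)\<^sup>2 \<le> t" "q x \<le> r" for x t r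
    using that by (auto simp: S_def)
  have primal: "ereal v \<le> ereal (q x) + \<rho> ((norm x)\<^sup>2)" for x
    unfolding v[symmetric] v_rr_def q_def by (rule INF_lower) simp
  \<comment> \<open>A common point would, as \<rho> is monotone, give an \<open>x\<close> with
    primal value below \<open>v\<close>.\<close>
  have "S \<inter> T = {}"
  proof (safe, goal_cases)
    case (1 t r)
    then obtain x where x: "(norm x)\<^sup>2 \<le> t" "q x \<le> r" and r: "\<rho> t < ereal (v - r)"
      by (auto simp: S_def T_def)
    have "\<rho> ((norm x)\<^sup>2) \<le> \<rho> t" using \<open>mono \<rho>\<close> x(1) by (rule monoD)
    then have "\<rho> ((norm x)\<^sup>2) < ereal (v - q x)"
      using r x(2) by (smt (verit) ereal_less_eq(3) order_le_less_trans order_less_le_trans)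
    then show ?case
      using primal[of x] by (cases "\<rho> ((norm x)\<^sup>2)") auto
  qed
  moreover have "convex S" "convex T"
    unfolding S_def T_def q_def
    by (rule convex_quadratic_norm_set, rule convex_strict_hypograph[OF conv])
  moreover have S0: "(t, 0) \<in> S" if "0 \<le> t" for t using that by (intro S[of 0]) (auto simp: q_def)
  moreover have "(0, v - 1) \<in> T" using zero by (simp add: T_def)
  ultimately obtain p and b where p: "p \<noteq> 0" "\<forall>z\<in>T. p \<bullet> z \<le> b" "\<forall>z\<in>S. b \<le> p \<bullet> z"
    using separating_hyperplane_sets[of T S] by (metis empty_iff inf_commute order_refl)
  obtain m k where mk: "p = (m, k)" by fastforce
  have pS: "b \<le> m * t + k * r" if "(t, r) \<in> S" for t r using p(3) that by (auto simp: mk)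
  have pT: "m * t + k * r \<le> b" if "\<rho> t < ereal (v - r)" for t r
    using p(2) that by (auto simp: mk T_def)
  have "b \<le> 0" using pS[OF S0[of 0]] by simp
  have "0 \<le> m"
  proof (rule ccontr)
    assume "\<not> 0 \<le> m"
    then show False
      \<comment> \<open>This abscissa is nonnegative, as \<open>b \<le> 0\<close> and
        \<open>m < 0\<close>, and the linear form takes the value \<open>b - 1\<close>
        there.\<close>
      using pS[OF S0[of "(b - 1) / m"]] \<open>b \<le> 0\<close> by (simp add: divide_nonpos_neg)
  qed
  have "0 \<le> k"
  proof (rule ccontr)
    assume k: "\<not> 0 \<le> k"
    have "(0, (b - 1) / k) \<in> S"
      using k \<open>b \<le> 0\<close> by (intro S[of 0]) (auto simp: q_def divide_nonpos_neg)
    then show False using pS k by fastforce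
  qed
  obtain r0 where r0: "\<rho> t0 = ereal r0"
    using nonneg[of t0] slater(2) by (cases "\<rho> t0") auto
  \<comment> \<open>If \<open>k = 0\<close>, the point of \<open>T\<close> above
    \<open>t0 > 0\<close> gives \<open>m * t0 \<le> b \<le> 0\<close>, so the normal vector would
    vanish.\<close>
  have "k \<noteq> 0"
  proof
    assume k: "k = 0"
    then have "m * t0 \<le> 0" using pT[of t0 "v - r0 - 1"] r0 \<open>b \<le> 0\<close> by simp
    then have "m = 0" using \<open>0 \<le> m\<close> slater(1) by (simp add: mult_le_0_iff)
    then show False using p(1) k mk by (simp add: zero_prod_def)
  qed
  with \<open>0 \<le> k\<close> have k: "0 < k" by simp
  \<comment> \<open>Slope and intercept of the separating line solved for \<open>r\<close>, namely
    \<open>r = l * t + c\<close>.\<close>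
  define l where "l = - (m / k)"
  define c where "c = b / k"
  let ?M = "H - l *\<^sub>R mat 1"
  have "l \<le> 0" using k \<open>0 \<le> m\<close> by (simp add: l_def)
  have bd: "c \<le> 2 * (g \<bullet> x) + x \<bullet> (?M *v x)" for x
  proof -
    have "b \<le> m * (norm x)\<^sup>2 + k * q x" by (intro pS S) auto
    then have "c \<le> q x - l * (norm x)\<^sup>2" using k by (simp add: c_def l_def field_simps)
    then show ?thesis by (simp add: shifted_quadratic q_def)
  qed
  have symM: "transpose ?M = ?M"
    by (simp add: transpose_diff transpose_scalar sym transpose_mat)
  note M = bounded_below_imp_psd_range[OF symM bd]
  have conj: "monotone_conj \<rho> (- l) \<le> ereal (c - v)"
    unfolding monotone_conj_def
  proof (rule SUP_least)
    fix t :: real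
    show "ereal (- l * t) - \<rho> t \<le> ereal (c - v)"
    proof (cases "\<rho> t")
      case (real r)
      \<comment> \<open>\<open>T\<close> contains only points strictly below the graph of
        \<open>v - \<rho>\<close>; the graph itself is reached as \<open>e\<close> tends to
        0.\<close>
      have "m * t + k * (v - r) \<le> b + k * e" if "0 < e" for e
        using pT[of t "v - r - e"] real that by (simp add: algebra_simps)
      then have "m * t + k * (v - r) \<le> b + e" if "0 < e" for e
        using that k by (metis divide_pos_pos mult.commute nonzero_eq_divide_eq less_irrefl)
      then have "m * t + k * (v - r) \<le> b" by (rule field_le_epsilon)
      then have "(m * t + k * (v - r)) / k \<le> c"
        using k unfolding c_def by (intro divide_right_mono) auto
      then show ?thesis using k real by (simp add: l_def add_divide_distrib)
    qed (use nonneg[of t] in auto)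
  qed
  obtain x where "2 * (g \<bullet> x) + x \<bullet> (?M *v x) = - (g \<bullet> (pinv ?M *v g))"
    using pinv_lower_bound(2)[OF M] by blast
  then have "c \<le> - (g \<bullet> (pinv ?M *v g))" using bd by metis
  then have "ereal c - ereal (c - v) \<le> dual_obj g H \<rho> l"
    unfolding dual_obj_def by (intro ereal_minus_mono conj) simp
  moreover have "l \<in> dual_feasible g H"
    using \<open>l \<le> 0\<close> M by (simp add: dual_feasible_def)
  ultimately show ?thesis by (intro bexI[of _ l]) auto
qed

theorem theorem2p1:
  fixes g :: "real ^ 'n" and H :: "real ^ 'n ^ 'n" and \<rho> :: "real \<Rightarrow> ereal"
  assumes "g \<noteq> 0"
    and "transpose H = H"
    and "\<And>t. 0 \<le> \<rho> t"
    and "proper_fun \<rho>" and "closed_fun \<rho>" and "convex_fun \<rho>"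
    and "\<rho> 0 = 0"
    and "mono \<rho>"
    and "\<And>t. t \<le> 0 \<Longrightarrow> \<rho> t = 0"
    and "\<exists>t0>0. \<rho> t0 < \<infinity>"
  shows "v_rd g H \<rho> = v_rr g H \<rho> \<and>
    (\<bar>v_rr g H \<rho>\<bar> \<noteq> \<infinity> \<longrightarrow>
      (\<exists>l\<in>dual_feasible g H. dual_obj g H \<rho> l = v_rd g H \<rho>))"
proof (cases "v_rr g H \<rho>")
  case (real v)
  obtain l where l: "l \<in> dual_feasible g H" "ereal v \<le> dual_obj g H \<rho> l"
    using strong_duality[OF assms(2,3,6,8,7) _ _ real] assms(10) by blast
  \<comment> \<open>With weak duality this closes the chain from \<open>v\<close> through the value
    at \<open>l\<close> and \<open>v_rd\<close> back to \<open>v\<close>, so \<open>l\<close>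
    attains the supremum.\<close>
  have "dual_obj g H \<rho> l \<le> v_rd g H \<rho>"
    unfolding v_rd_def using l(1) by (rule SUP_upper)
  then show ?thesis
    using l real weak_duality[of \<rho> g H, OF assms(3)] by (metis order_antisym order_trans)
next
  case PInf
  \<comment> \<open>The point \<open>x = 0\<close> has primal value 0, which rules out an infinite
    infimum from above.\<close>
  have "v_rr g H \<rho> \<le> ereal (2 * (g \<bullet> 0) + 0 \<bullet> (H *v 0)) + \<rho> ((norm (0 :: real ^ 'n))\<^sup>2)"
    unfolding v_rr_def by (rule INF_lower) simp
  then show ?thesis using PInf assms(7) by simp
next
  case MInf
  then show ?thesis using weak_duality[of \<rho> g H, OF assms(3)] by simp
qed

end
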